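(* Let $\Gamma$ and $\Gamma'$ be finite simple graphs with at least three vertices, let $f:V(\Gamma)\to V(\Gamma')$ be a bijection, and for each $v\in V(\Gamma)$ let $\phi_v:\Gamma-v\to\Gamma'-f(v)$ be a graph isomorphism. Let $\widetilde{\Gamma}$ be the associated directed graph of $(\Gamma,\Gamma',f,\{\phi_v\}_{v\in V(\Gamma)})$. Then for any vertex $v\in V(\Gamma)=V(\widetilde{\Gamma})$, the following two statements are equivalent: (i) There are no normal-arrows arising from $v$ (and no dashed-arrows arising from $v$) in $\widetilde{\Gamma}$. (ii) The isomorphism $\phi_v:\Gamma-v\to\Gamma'-f(v)$ extends to an isomorphism $\overline{\phi_v}:\Gamma\to\Gamma'$ with $\overline{\phi_v}|_{\Gamma-v}=\phi_v$ and $\overline{\phi_v}(v)=f(v)$.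
   Context: $\Gamma-v$ denotes the full (induced) subgraph of $\Gamma$ on $V(\Gamma)\setminus\{v\}$; $E(\Gamma)$ is the edge set and $[u,w]$ denotes an edge joining $u$ and $w$. The associated directed graph $\widetilde{\Gamma}=\widetilde{\Gamma}(\Gamma,\Gamma',f,\{\phi_v\}_{v\in V(\Gamma)})$ has vertex set $V(\widetilde{\Gamma})=V(\Gamma)$ and two kinds of arrows. There is a normal-arrow from $v_1$ to $v_2$, written $v_1\longrightarrow v_2$, if and only if $v_2\ne v_1$, $[v_1,v_2]\notin E(\Gamma)$ and $[f(v_1),\phi_{v_1}(v_2)]\in E(\Gamma')$. There is a dashed-arrow from $v_1$ to $v_2$, written $v_1\dashrightarrow v_2$, if and only if $v_2\neq v_1$, $[f(v_1),f(v_2)]\notin E(\Gamma')$ and $[v_1,\phi_{v_1}^{-1}(f(v_2))]\in E(\Gamma)$. (The condition $v_2\ne v_1$ is needed for $\phi_{v_1}(v_2)$ and $\phi_{v_1}^{-1}(f(v_2))$ to be defined.) An arrow "arises from $v$" if $v$ is its starting vertex. For every $v$ the number of normal-arrows arising from $v$ equals the number of dashed-arrows arising from $v$, so the parenthetical clause in (i) is equivalent to the first clause. *)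

theory Defs
  imports Main
begin

text \<open>
  An undirected edge \<open>[u,w]\<close> is the two-element vertex set \<open>{u, w}\<close>.
\<close>

record 'a ugraph =
  verts :: "'a set"
  edges :: "'a set set"

definition finite_simple_graph :: "'a ugraph \<Rightarrow> bool" where
  "finite_simple_graph G \<longleftrightarrow>
     finite (verts G) \<and>
     edges G \<subseteq> {{u, w} | u w. u \<in> verts G \<and> w \<in> verts G \<and> u \<noteq> w}"

definition induced_subgraph :: "'a ugraph \<Rightarrow> 'a set \<Rightarrow> 'a ugraph" where
  "induced_subgraph G S =
     \<lparr>verts = verts G \<inter> S, edges = {e \<in> edges G. e \<subseteq> S}\<rparr>"

definition delete_vertex :: "'a ugraph \<Rightarrow> 'a \<Rightarrow> 'a ugraph" where
  "delete_vertex G v = induced_subgraph G (verts G - {v})"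

text \<open>
  Maps between graphs are total functions on the underlying types; only the values on the
  vertex set of the source graph are significant.
\<close>

definition graph_iso :: "'a ugraph \<Rightarrow> 'b ugraph \<Rightarrow> ('a \<Rightarrow> 'b) \<Rightarrow> bool" where
  "graph_iso G H h \<longleftrightarrow>
     bij_betw h (verts G) (verts H) \<and>
     (\<forall>u \<in> verts G. \<forall>w \<in> verts G. {u, w} \<in> edges G \<longleftrightarrow> {h u, h w} \<in> edges H)"

text \<open>
  A directed graph with two kinds of arrows; \<open>(u, w)\<close> is the arrow that starts at \<open>u\<close>
  and ends at \<open>w\<close>.
\<close>

record 'a arrow_graph =
  arrow_verts :: "'a set"
  normal_arrows :: "('a \<times> 'a) set"
  dashed_arrows :: "('a \<times> 'a) set"

text \<open>
  The inverse of \<open>\<phi> v\<^sub>1\<close> is taken relative to its domain, the vertex set of \<open>G\<close> without \<open>v\<^sub>1\<close>.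
\<close>

definition associated_digraph ::
  "'a ugraph \<Rightarrow> 'b ugraph \<Rightarrow> ('a \<Rightarrow> 'b) \<Rightarrow> ('a \<Rightarrow> 'a \<Rightarrow> 'b) \<Rightarrow> 'a arrow_graph" where
  "associated_digraph G G' f \<phi> =
     \<lparr>arrow_verts = verts G,
      normal_arrows =
        {(v\<^sub>1, v\<^sub>2). v\<^sub>1 \<in> verts G \<and> v\<^sub>2 \<in> verts G \<and> v\<^sub>2 \<noteq> v\<^sub>1 \<and>
           {v\<^sub>1, v\<^sub>2} \<notin> edges G \<and> {f v\<^sub>1, \<phi> v\<^sub>1 v\<^sub>2} \<in> edges G'},
      dashed_arrows =
        {(v\<^sub>1, v\<^sub>2). v\<^sub>1 \<in> verts G \<and> v\<^sub>2 \<in> verts G \<and> v\<^sub>2 \<noteq> v\<^sub>1 \<and>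
           {f v\<^sub>1, f v\<^sub>2} \<notin> edges G' \<and>
           {v\<^sub>1, inv_into (verts (delete_vertex G v\<^sub>1)) (\<phi> v\<^sub>1) (f v\<^sub>2)} \<in> edges G}\<rparr>"

definition no_normal_arrows_from :: "'a arrow_graph \<Rightarrow> 'a \<Rightarrow> bool" where
  "no_normal_arrows_from D v \<longleftrightarrow> (\<nexists>w. (v, w) \<in> normal_arrows D)"

definition no_dashed_arrows_from :: "'a arrow_graph \<Rightarrow> 'a \<Rightarrow> bool" where
  "no_dashed_arrows_from D v \<longleftrightarrow> (\<nexists>w. (v, w) \<in> dashed_arrows D)"

definition extends_to_iso ::
  "'a ugraph \<Rightarrow> 'b ugraph \<Rightarrow> ('a \<Rightarrow> 'b) \<Rightarrow> ('a \<Rightarrow> 'a \<Rightarrow> 'b) \<Rightarrow> 'a \<Rightarrow> bool" where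
  "extends_to_iso G G' f \<phi> v \<longleftrightarrow>
     (\<exists>\<psi>. graph_iso G G' \<psi> \<and>
          (\<forall>u \<in> verts (delete_vertex G v). \<psi> u = \<phi> v u) \<and>
          \<psi> v = f v)"

end

theory Submission
  imports Defs
begin

text \<open>
  By Kelly's double counting, each edge survives in exactly \<open>n - 2\<close> vertex-deleted subgraphs, so the
  isomorphic cards force \<open>G\<close> and \<open>G'\<close> to have equally many edges, and hence \<open>v\<close> and \<open>f v\<close> to have
  equal degree. Absence of normal arrows from \<open>v\<close> says that the neighbourhood of \<open>f v\<close> lies
  inside the \<open>\<phi> v\<close>-image of the neighbourhood of \<open>v\<close>; having the same finite size, the two sets
  are equal, which is precisely what the extension of \<open>\<phi> v\<close> by \<open>v \<mapsto> f v\<close> needs.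
\<close>

section \<open>Edges, neighbourhoods and vertex deletion\<close>

definition nbrs :: "'a ugraph \<Rightarrow> 'a \<Rightarrow> 'a set" where
  "nbrs G v = {w \<in> verts G. {v, w} \<in> edges G}"

lemma finite_verts: "finite_simple_graph G \<Longrightarrow> finite (verts G)"
  by (simp add: finite_simple_graph_def)

lemma edgeE:
  assumes "finite_simple_graph G" "e \<in> edges G"
  obtains u w where "e = {u, w}" "u \<in> verts G" "w \<in> verts G" "u \<noteq> w"
  using assms unfolding finite_simple_graph_def by blast

lemma no_loop: "finite_simple_graph G \<Longrightarrow> {v, v} \<notin> edges G"
  by (auto elim!: edgeE)

lemma edge_subset_verts: "finite_simple_graph G \<Longrightarrow> e \<in> edges G \<Longrightarrow> e \<subseteq> verts G"
  by (auto elim!: edgeE)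

lemma finite_edges:
  assumes "finite_simple_graph G"
  shows "finite (edges G)"
proof (rule finite_subset)
  show "edges G \<subseteq> Pow (verts G)"
    using edge_subset_verts[OF assms] by blast
  show "finite (Pow (verts G))"
    using finite_verts[OF assms] by simp
qed

lemma verts_delete_vertex: "verts (delete_vertex G v) = verts G - {v}"
  by (auto simp: delete_vertex_def induced_subgraph_def)

text \<open>Every edge already lies inside \<open>verts G\<close>, so being contained in
  \<open>verts G - {v}\<close> reduces to avoiding \<open>v\<close>, the form that double counting
  needs.\<close>

lemma edges_delete_vertex:
  assumes "finite_simple_graph G"
  shows "edges (delete_vertex G v) = {e \<in> edges G. v \<notin> e}"
  using edge_subset_verts[OF assms]
  by (auto simp: delete_vertex_def induced_subgraph_def)

lemma finite_simple_graph_delete_vertex: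
  assumes "finite_simple_graph G"
  shows "finite_simple_graph (delete_vertex G v)"
  unfolding finite_simple_graph_def
proof
  show "finite (verts (delete_vertex G v))"
    using finite_verts[OF assms] by (simp add: verts_delete_vertex)
  show "edges (delete_vertex G v) \<subseteq> {{u, w} |u w. u \<in> verts (delete_vertex G v) \<and>
      w \<in> verts (delete_vertex G v) \<and> u \<noteq> w}"
  proof
    fix e assume "e \<in> edges (delete_vertex G v)"
    then have "e \<in> edges G" "v \<notin> e"
      by (simp_all add: edges_delete_vertex[OF assms])
    then show "e \<in> {{u, w} |u w. u \<in> verts (delete_vertex G v) \<and>
        w \<in> verts (delete_vertex G v) \<and> u \<noteq> w}"
      by (elim edgeE[OF assms]) (auto simp: verts_delete_vertex)
  qed
qed

section \<open>Isomorphism invariance of the number of edges\<close>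

lemma edge_image_graph_iso:
  assumes "finite_simple_graph G" "finite_simple_graph H" "graph_iso G H h"
  shows "edges H = image h ` edges G"
proof
  have bij: "bij_betw h (verts G) (verts H)"
    and iff: "\<And>u w. u \<in> verts G \<Longrightarrow> w \<in> verts G \<Longrightarrow> {u, w} \<in> edges G \<longleftrightarrow> {h u, h w} \<in> edges H"
    using assms(3) by (auto simp: graph_iso_def)
  show "edges H \<subseteq> image h ` edges G"
  proof
    fix e assume e: "e \<in> edges H"
    obtain u' w' where u'w': "e = {u', w'}" "u' \<in> verts H" "w' \<in> verts H"
      using edgeE[OF assms(2) e] .
    then obtain u w where "u \<in> verts G" "w \<in> verts G" "u' = h u" "w' = h w"
      using bij_betw_imp_surj_on[OF bij] by blast
    with iff e u'w' have "{u, w} \<in> edges G" "e = h ` {u, w}"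
      by auto
    then show "e \<in> image h ` edges G" by blast
  qed
  show "image h ` edges G \<subseteq> edges H"
  proof
    fix d assume "d \<in> image h ` edges G"
    then obtain e where e: "e \<in> edges G" "d = h ` e" by blast
    obtain u w where "e = {u, w}" "u \<in> verts G" "w \<in> verts G"
      using edgeE[OF assms(1) e(1)] .
    with iff e show "d \<in> edges H" by simp
  qed
qed

lemma card_edges_graph_iso:
  assumes "finite_simple_graph G" "finite_simple_graph H" "graph_iso G H h"
  shows "card (edges H) = card (edges G)"
proof -
  have "inj_on h (verts G)"
    using assms(3) by (simp add: graph_iso_def bij_betw_def)
  \<comment> \<open>Edges are subsets of \<open>verts G\<close>, so injectivity of \<open>h\<close>
    on vertices lifts to injectivity on edges.\<close>
  then have "inj_on (image h) (edges G)"
    by (rule inj_on_subset[OF inj_on_image_Pow]) (use edge_subset_verts[OF assms(1)] in blast)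
  then show ?thesis
    by (simp add: edge_image_graph_iso[OF assms] card_image)
qed

section \<open>Kelly's count and equality of degrees\<close>

text \<open>Pairs \<open>(v, e)\<close> with \<open>v \<notin> e\<close> are counted in two ways: an
  edge avoids all vertices but its two ends. Truncated subtraction does no harm, since any edge
  forces at least two vertices.\<close>

lemma kelly_count:
  assumes "finite_simple_graph G"
  shows "(\<Sum>v\<in>verts G. card (edges (delete_vertex G v))) = (card (verts G) - 2) * card (edges G)"
proof -
  have "(\<Sum>v\<in>verts G. card {e \<in> edges G. v \<notin> e}) = (card (verts G) - 2) * card (edges G)"
  proof (rule sum_multicount[OF finite_verts[OF assms] finite_edges[OF assms]], rule ballI)
    fix e assume e: "e \<in> edges G"
    have sub: "e \<subseteq> verts G"
      by (rule edge_subset_verts[OF assms e])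
    moreover have "card e = 2"
      using e by (elim edgeE[OF assms]) simp
    moreover have "{v \<in> verts G. v \<notin> e} = verts G - e" by blast
    ultimately show "card {v \<in> verts G. v \<notin> e} = card (verts G) - 2"
      using finite_subset[OF sub finite_verts[OF assms]] by (simp add: card_Diff_subset)
  qed
  then show ?thesis by (simp add: edges_delete_vertex[OF assms])
qed

text \<open>Edges either avoid \<open>v\<close> or contain it; those containing it correspond to the
  neighbours \<open>w\<close> via \<open>{v, w}\<close>. Degree is thus the number of edges lost by
  deleting \<open>v\<close>.\<close>

lemma card_edges_vertex:
  assumes "finite_simple_graph G"
  shows "card (edges G) = card (edges (delete_vertex G v)) + card (nbrs G v)"
proof -
  have inc: "{e \<in> edges G. v \<in> e} = (\<lambda>w. {v, w}) ` nbrs G v"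
  proof
    show "{e \<in> edges G. v \<in> e} \<subseteq> (\<lambda>w. {v, w}) ` nbrs G v"
    proof
      fix e assume e: "e \<in> {e \<in> edges G. v \<in> e}"
      then obtain u u' where "e = {u, u'}" "u \<in> verts G" "u' \<in> verts G" "v \<in> e"
        using edgeE[OF assms, of e] by blast
      then obtain w where "w \<in> verts G" "e = {v, w}"
        by blast
      with e show "e \<in> (\<lambda>w. {v, w}) ` nbrs G v"
        by (auto simp: nbrs_def)
    qed
  qed (auto simp: nbrs_def)
  have "inj_on (\<lambda>w. {v, w}) (nbrs G v)"
    by (auto simp: inj_on_def doubleton_eq_iff)
  then have "card (nbrs G v) = card {e \<in> edges G. v \<in> e}"
    by (simp add: inc card_image)
  moreover have "card ({e \<in> edges G. v \<notin> e} \<union> {e \<in> edges G. v \<in> e}) =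
      card {e \<in> edges G. v \<notin> e} + card {e \<in> edges G. v \<in> e}"
    using finite_edges[OF assms] by (intro card_Un_disjoint) auto
  moreover have "{e \<in> edges G. v \<notin> e} \<union> {e \<in> edges G. v \<in> e} = edges G" by blast
  ultimately show ?thesis by (simp add: edges_delete_vertex[OF assms])
qed

lemma card_edges_hypomorphic:
  assumes "finite_simple_graph G" "finite_simple_graph G'" "card (verts G) \<ge> 3"
    and f: "bij_betw f (verts G) (verts G')"
    and iso: "\<And>u. u \<in> verts G \<Longrightarrow> graph_iso (delete_vertex G u) (delete_vertex G' (f u)) (\<phi> u)"
  shows "card (edges G') = card (edges G)"
proof -
  have "(card (verts G') - 2) * card (edges G') = (\<Sum>u\<in>verts G. card (edges (delete_vertex G' (f u))))"
    unfolding kelly_count[OF assms(2), symmetric] by (rule sum.reindex_bij_betw[OF f, symmetric])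
  also have "\<dots> = (\<Sum>u\<in>verts G. card (edges (delete_vertex G u)))"
    by (intro sum.cong refl card_edges_graph_iso[OF _ _ iso]
        finite_simple_graph_delete_vertex assms(1,2))
  also have "\<dots> = (card (verts G) - 2) * card (edges G)"
    by (rule kelly_count[OF assms(1)])
  \<comment> \<open>At least three vertices make the common factor \<open>n - 2\<close> positive, so
    it cancels.\<close>
  finally show ?thesis
    using bij_betw_same_card[OF f] assms(3) by simp
qed

lemma card_nbrs_hypomorphic:
  assumes "finite_simple_graph G" "finite_simple_graph G'" "card (verts G) \<ge> 3"
    and "bij_betw f (verts G) (verts G')"
    and iso: "\<And>u. u \<in> verts G \<Longrightarrow> graph_iso (delete_vertex G u) (delete_vertex G' (f u)) (\<phi> u)"
    and "v \<in> verts G"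
  shows "card (nbrs G' (f v)) = card (nbrs G v)"
proof -
  have "card (edges (delete_vertex G' (f v))) = card (edges (delete_vertex G v))"
    by (intro card_edges_graph_iso[OF _ _ iso] finite_simple_graph_delete_vertex assms(1,2,6))
  with card_edges_hypomorphic[OF assms(1-5)] show ?thesis
    using card_edges_vertex[OF assms(1), of v] card_edges_vertex[OF assms(2), of "f v"] by simp
qed

section \<open>Extending a card isomorphism, and absence of arrows\<close>

text \<open>Pairs avoiding \<open>v\<close> are handled by \<open>\<phi> v\<close> itself, so only
  adjacency to \<open>v\<close> remains to be checked.\<close>

lemma extends_to_iso_iff_nbrs:
  assumes G: "finite_simple_graph G" and G': "finite_simple_graph G'"
    and v: "v \<in> verts G" and fv: "f v \<in> verts G'"
    and iso: "graph_iso (delete_vertex G v) (delete_vertex G' (f v)) (\<phi> v)"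
  shows "extends_to_iso G G' f \<phi> v \<longleftrightarrow>
    (\<forall>w \<in> verts G - {v}. {v, w} \<in> edges G \<longleftrightarrow> {f v, \<phi> v w} \<in> edges G')"
    (is "_ \<longleftrightarrow> ?R")
proof
  assume "extends_to_iso G G' f \<phi> v"
  then show ?R
    using v by (auto simp: extends_to_iso_def graph_iso_def verts_delete_vertex)
next
  assume R: ?R
  \<comment> \<open>On \<open>verts G\<close> this is the only possible extension.\<close>
  define \<psi> where "\<psi> = (\<phi> v)(v := f v)"
  have bij: "bij_betw (\<phi> v) (verts G - {v}) (verts G' - {f v})"
    using iso by (simp add: graph_iso_def verts_delete_vertex)
  then have "bij_betw \<psi> (verts G - {v}) (verts G' - {f v})"
    by (rule bij_betw_cong[THEN iffD1, rotated]) (auto simp: \<psi>_def)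
  then have "bij_betw \<psi> (insert v (verts G - {v})) (insert (f v) (verts G' - {f v}))"
    using notIn_Un_bij_betw[of v "verts G - {v}" \<psi> "verts G' - {f v}"] by (simp add: \<psi>_def)
  then have "bij_betw \<psi> (verts G) (verts G')"
    using v fv by (simp add: insert_absorb)
  moreover have "{u, w} \<in> edges G \<longleftrightarrow> {\<psi> u, \<psi> w} \<in> edges G'"
    if uw: "u \<in> verts G" "w \<in> verts G" for u w
  proof -
    consider "u = v" "w = v" | "u = v" "w \<noteq> v" | "u \<noteq> v" "w = v" | "u \<noteq> v" "w \<noteq> v" by blast
    then show ?thesis
    proof cases
      case 1
      then show ?thesis
        using no_loop[OF G] no_loop[OF G'] by simp
    next
      case 2
      then show ?thesis using R uw by (simp add: \<psi>_def)
    next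
      case 3
      then show ?thesis using R uw by (simp add: \<psi>_def insert_commute)
    next
      case 4
      \<comment> \<open>Both images differ from \<open>f v\<close>, so adjacency in
        \<open>G'\<close> and in \<open>G'\<close> with \<open>f v\<close> deleted agree on
        them.\<close>
      moreover from this uw have "\<phi> v u \<noteq> f v" "\<phi> v w \<noteq> f v"
        using bij by (auto simp: bij_betw_def)
      moreover have "{u, w} \<in> edges (delete_vertex G v) \<longleftrightarrow>
          {\<phi> v u, \<phi> v w} \<in> edges (delete_vertex G' (f v))"
        using iso uw 4 by (simp add: graph_iso_def verts_delete_vertex)
      ultimately show ?thesis
        by (simp add: edges_delete_vertex G G' \<psi>_def)
    qed
  qed
  ultimately show "extends_to_iso G G' f \<phi> v"
    unfolding extends_to_iso_def graph_iso_def
    by (intro exI[of _ \<psi>]) (simp add: \<psi>_def verts_delete_vertex)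
qed

theorem theorem3p3:
  fixes G :: "'a ugraph" and G' :: "'b ugraph"
    and f :: "'a \<Rightarrow> 'b" and \<phi> :: "'a \<Rightarrow> 'a \<Rightarrow> 'b" and v :: 'a
  assumes "finite_simple_graph G" and "finite_simple_graph G'"
    and "card (verts G) \<ge> 3" and "card (verts G') \<ge> 3"
    and "bij_betw f (verts G) (verts G')"
    and "\<And>u. u \<in> verts G \<Longrightarrow>
           graph_iso (delete_vertex G u) (delete_vertex G' (f u)) (\<phi> u)"
    and "v \<in> arrow_verts (associated_digraph G G' f \<phi>)"
  shows "(no_normal_arrows_from (associated_digraph G G' f \<phi>) v
            \<longleftrightarrow> extends_to_iso G G' f \<phi> v) \<and>
         ((no_normal_arrows_from (associated_digraph G G' f \<phi>) v \<and>
           no_dashed_arrows_from (associated_digraph G G' f \<phi>) v)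
            \<longleftrightarrow> extends_to_iso G G' f \<phi> v)"
proof -
  let ?D = "associated_digraph G G' f \<phi>"
  note G = assms(1) and G' = assms(2) and f = assms(5)
  have v: "v \<in> verts G"
    using assms(7) by (simp add: associated_digraph_def)
  have fv: "f v \<in> verts G'"
    using bij_betwE[OF f] v by blast
  have bij: "bij_betw (\<phi> v) (verts G - {v}) (verts G' - {f v})"
    using assms(6)[OF v] by (simp add: graph_iso_def verts_delete_vertex)
  note ext = extends_to_iso_iff_nbrs[of G G' v f \<phi>, OF G G' v fv assms(6)[OF v]]
  \<comment> \<open>This is one direction of the adjacency criterion \<open>ext\<close>; the other
    has to come from counting.\<close>
  have normal: "no_normal_arrows_from ?D v \<longleftrightarrow>
      (\<forall>w \<in> verts G - {v}. {f v, \<phi> v w} \<in> edges G' \<longrightarrow> {v, w} \<in> edges G)"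
    using v by (auto simp: no_normal_arrows_from_def associated_digraph_def)
  have ext_if_normal: "extends_to_iso G G' f \<phi> v" if "no_normal_arrows_from ?D v"
  proof -
    have nv: "nbrs G v \<subseteq> verts G - {v}" and nfv: "nbrs G' (f v) \<subseteq> verts G' - {f v}"
      using no_loop[OF G, of v] no_loop[OF G', of "f v"] by (auto simp: nbrs_def)
    have inj: "inj_on (\<phi> v) (verts G - {v})"
      using bij by (rule bij_betw_imp_inj_on)
    have sub: "nbrs G' (f v) \<subseteq> \<phi> v ` nbrs G v"
    proof
      fix x assume x: "x \<in> nbrs G' (f v)"
      then obtain w where "w \<in> verts G - {v}" "x = \<phi> v w"
        using nfv bij by (auto simp: bij_betw_def)
      then show "x \<in> \<phi> v ` nbrs G v"
        using x that normal by (auto simp: nbrs_def)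
    qed
    have fin: "finite (nbrs G v)"
      using finite_verts[OF G] by (simp add: nbrs_def)
    have "card (\<phi> v ` nbrs G v) = card (nbrs G v)"
      using inj_on_subset[OF inj nv] by (rule card_image)
    also have "\<dots> = card (nbrs G' (f v))"
      using card_nbrs_hypomorphic[OF G G' assms(3) f assms(6) v] by simp
    \<comment> \<open>A subset of a finite set with the same cardinality is the whole set. The
      isomorphisms at the other vertices enter here, through the equality of degrees.\<close>
    finally have eq: "nbrs G' (f v) = \<phi> v ` nbrs G v"
      using sub fin by (intro card_subset_eq) auto
    have "{f v, \<phi> v w} \<in> edges G'" if "w \<in> verts G - {v}" "{v, w} \<in> edges G" for w
    proof -
      have "w \<in> nbrs G v" using that by (simp add: nbrs_def)
      then have "\<phi> v w \<in> nbrs G' (f v)" unfolding eq by (rule imageI)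
      then show ?thesis by (simp add: nbrs_def)
    qed
    then show ?thesis
      using that normal ext by blast
  qed
  have dashed_if_ext: "no_dashed_arrows_from ?D v" if E: "extends_to_iso G G' f \<phi> v"
    unfolding no_dashed_arrows_from_def
  proof
    assume "\<exists>w. (v, w) \<in> dashed_arrows ?D"
    then obtain w where w: "w \<in> verts G" "w \<noteq> v" "{f v, f w} \<notin> edges G'"
      and e: "{v, inv_into (verts G - {v}) (\<phi> v) (f w)} \<in> edges G"
      by (auto simp: associated_digraph_def verts_delete_vertex)
    have "f w \<in> verts G'" "f w \<noteq> f v"
      using bij_betwE[OF f] bij_betw_imp_inj_on[OF f] v w(1,2) by (auto dest: inj_onD)
    \<comment> \<open>Injectivity of \<open>f\<close> puts \<open>f w\<close> in the range of
      \<open>\<phi> v\<close>, so \<open>inv_into\<close> yields a genuine preimage.\<close>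
    then have fw: "f w \<in> \<phi> v ` (verts G - {v})"
      using bij by (simp add: bij_betw_def)
    then have "{f v, \<phi> v (inv_into (verts G - {v}) (\<phi> v) (f w))} \<in> edges G'"
      using E e inv_into_into[OF fw] unfolding ext by blast
    then show False
      using w(3) f_inv_into_f[OF fw] by simp
  qed
  \<comment> \<open>An extension excludes normal arrows by one half of \<open>ext\<close>, and
    dashed arrows by \<open>dashed_if_ext\<close>; so both forms of (i) are covered.\<close>
  show ?thesis
    using ext_if_normal dashed_if_ext normal ext by blast
qed

end
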